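(* Let $p$ be a prime, let $A=\{\mathbf a_1,\dots,\mathbf a_N\}\subseteq\mathbb Z^n$, and let $\beta$ be such that $R_\beta\neq\emptyset$. If $v\in R_\beta$, then the series $\Phi_v(\lambda)$ has $p$-integral coefficients if and only if $w(v)=w(R_\beta)$. If $w(v)>w(R_\beta)$, then the coefficients of $\Phi_v(\lambda)$ are $p$-adically unbounded.
   Context: $\mathbb N$ = nonnegative integers. Let $L=\{l=(l_1,\dots,l_N)\in\mathbb Z^N : \sum_{i=1}^N l_i\mathbf a_i=\mathbf 0\}$. For a vector $v=(v_1,\dots,v_N)$ put ${\rm nsupp}(v)=\{i : v_i \text{ is a negative integer}\}$ and $L_v=\{l\in L : {\rm nsupp}(v+l)={\rm nsupp}(v)\}$. Put $[v]_{l_-}=\prod_{l_i<0}\prod_{j=1}^{-l_i}(v_i-j+1)$ and $[v+l]_{l_+}=\prod_{l_i>0}\prod_{j=1}^{l_i}(v_i+j)$. Fix $\pi$ (in an algebraic closure of $\mathbb Q_p$) with $\pi^{p-1}=-p$, and define the formal series $$\Phi_v(\lambda)=\sum_{l\in L_v}\frac{[v]_{l_-}}{[v+l]_{l_+}}\pi^{\sum_{i=1}^N l_i}\lambda^{v+l},$$ whose coefficients are the numbers $\frac{[v]_{l_-}}{[v+l]_{l_+}}\pi^{\sum l_i}$, $l\in L_v$. "$p$-integral" means ${\rm ord}_p\ge 0$, where ${\rm ord}_p$ is the $p$-adic valuation with ${\rm ord}_p\,p=1$; "$p$-adically unbounded" means ${\rm ord}_p$ of the coefficients is not bounded below. For $t\in\mathbb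 N$ with base-$p$ expansion $t=t_0+t_1p+\cdots+t_{b-1}p^{b-1}$, $0\le t_j\le p-1$, put $w_p(t)=\sum_j t_j$; for $s\in\mathbb N^N$ put $w_p(s)=\sum_{i=1}^N w_p(s_i)$. Let $R$ be the set of all $r=(r_1,\dots,r_N)\in(\mathbb Q\cap\mathbb Z_p)^N$ with $-1\le r_i\le 0$ for all $i$. For $r\in R$ choose a positive integer $a$ with $(1-p^a)r\in\mathbb N^N$ and put $w(r)=w_p((1-p^a)r)/a$ (independent of the choice of $a$). For $\beta$ put $R_\beta=\{r\in R : \sum_{i=1}^N r_i\mathbf a_i=\beta\}$ and $w(R_\beta)=\inf\{w(r) : r\in R_\beta\}$. *)

theory Defs
  imports "HOL-Analysis.Analysis" "HOL-Computational_Algebra.Computational_Algebra"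
begin

section \<open>The $p$-adic valuation and algebraic closures of $\mathbf{Q}_p$\<close>

definition rat_ord :: "nat \<Rightarrow> rat \<Rightarrow> ereal" where
  "rat_ord p x =
    (if x = 0 then \<infinity>
     else ereal (real (multiplicity (int p) (fst (quotient_of x))) -
                 real (multiplicity (int p) (snd (quotient_of x)))))"

text \<open>
  No type of $p$-adic numbers is available, so an algebraic closure of $\mathbf{Q}_p$ together
  with its valuation is described axiomatically: an algebraically closed field \<open>'k\<close> with a
  valuation that extends the $p$-adic one on the rationals, such that the topological closure of
  the rationals in \<open>'k\<close> is complete (hence is the completion $\mathbf{Q}_p$), and such that
  \<open>'k\<close> is algebraic over that closure. This determines the pair (field, valuation) up to
  isomorphism.
\<close>

locale padic_alg_closure =
  fixes p :: nat and ord :: "'k :: {alg_closed_field, field_char_0} \<Rightarrow> ereal"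
  assumes ord_not_minus_infinity: "ord x \<noteq> -\<infinity>"
    and ord_eq_infinity_iff: "ord x = \<infinity> \<longleftrightarrow> x = 0"
    and ord_mult: "ord (x * y) = ord x + ord y"
    and ord_add: "min (ord x) (ord y) \<le> ord (x + y)"
    and ord_of_rat: "ord (of_rat q) = rat_ord p q"
    and rat_Cauchy_convergent:
      "\<lbrakk>\<And>B :: real. \<exists>M :: nat. \<forall>m\<ge>M. \<forall>n\<ge>M. ereal B < ord (of_rat (s m) - of_rat (s n))\<rbrakk>
        \<Longrightarrow> \<exists>x. \<forall>B :: real. \<exists>M. \<forall>n\<ge>M. ereal B < ord (of_rat (s n) - x)"
    and algebraic_over_Qp:
      "\<exists>f :: 'k poly. f \<noteq> 0 \<and> poly f x = 0 \<and>
         (\<forall>i. \<forall>B :: real. \<exists>q. ereal B < ord (coeff f i - of_rat q))"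


section \<open>The series $\Phi_v$\<close>

definition rel_lattice :: "('m::finite \<Rightarrow> int ^ 'n) \<Rightarrow> (int ^ 'm) set" where
  "rel_lattice a = {l. (\<Sum>i\<in>UNIV. l $ i *s a i) = 0}"

definition vec_of_int :: "int ^ 'm \<Rightarrow> rat ^ 'm" where
  "vec_of_int l = (\<chi> i. of_int (l $ i))"

definition nsupp :: "rat ^ 'm \<Rightarrow> 'm set" where
  "nsupp v = {i. v $ i \<in> \<int> \<and> v $ i < 0}"

definition rel_lattice_at :: "('m::finite \<Rightarrow> int ^ 'n) \<Rightarrow> rat ^ 'm \<Rightarrow> (int ^ 'm) set" where
  "rel_lattice_at a v = {l \<in> rel_lattice a. nsupp (v + vec_of_int l) = nsupp v}"

definition bracket_minus :: "rat ^ 'm \<Rightarrow> int ^ 'm::finite \<Rightarrow> rat" where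
  "bracket_minus v l = (\<Prod>i | l $ i < 0. \<Prod>j = 1..nat (- (l $ i)). v $ i - of_nat j + 1)"

definition bracket_plus :: "rat ^ 'm \<Rightarrow> int ^ 'm::finite \<Rightarrow> rat" where
  "bracket_plus v l = (\<Prod>i | l $ i > 0. \<Prod>j = 1..nat (l $ i). v $ i + of_nat j)"

text \<open>
  The quantity \<open>bracket_plus v l\<close> is $[v+l]_{l_+}$. It does not vanish for
  \<open>l \<in> rel_lattice_at a v\<close>: a zero factor would mean that a negative integer entry of \<open>v\<close>
  becomes nonnegative in \<open>v + l\<close>.
\<close>

definition Phi_coeff :: "'k::field_char_0 \<Rightarrow> rat ^ 'm \<Rightarrow> int ^ 'm::finite \<Rightarrow> 'k" where
  "Phi_coeff \<pi> v l =
     of_rat (bracket_minus v l / bracket_plus v l) * \<pi> powi (\<Sum>i\<in>UNIV. l $ i)"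

text \<open>
  A formal series in $\lambda$ with exponents in $\mathbf{Q}^N$ is represented by the function
  that maps an exponent \<open>e\<close> to the coefficient of $\lambda^e$. The index set of the sum below
  has at most one element.
\<close>

definition Phi ::
    "('m::finite \<Rightarrow> int ^ 'n) \<Rightarrow> 'k::field_char_0 \<Rightarrow> rat ^ 'm \<Rightarrow> (rat ^ 'm \<Rightarrow> 'k)" where
  "Phi a \<pi> v = (\<lambda>e. \<Sum>l | l \<in> rel_lattice_at a v \<and> v + vec_of_int l = e. Phi_coeff \<pi> v l)"

text \<open>
  Exponents that do not occur have coefficient \<open>0\<close>, of order \<open>\<infinity>\<close>, so they affect neither
  of the following two notions.
\<close>

definition integral_coeffs :: "('k \<Rightarrow> ereal) \<Rightarrow> ('e \<Rightarrow> 'k) \<Rightarrow> bool" where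
  "integral_coeffs ord F \<longleftrightarrow> (\<forall>e. 0 \<le> ord (F e))"

definition unbounded_coeffs :: "('k \<Rightarrow> ereal) \<Rightarrow> ('e \<Rightarrow> 'k) \<Rightarrow> bool" where
  "unbounded_coeffs ord F \<longleftrightarrow> \<not> (\<exists>B :: real. \<forall>e. ereal B \<le> ord (F e))"


section \<open>Weights\<close>

text \<open>Since $p^j > t$ for $j \ge t$, the first \<open>t\<close> base-\<open>p\<close> digits of \<open>t\<close> are all of them.\<close>

definition digit_weight :: "nat \<Rightarrow> nat \<Rightarrow> nat" where
  "digit_weight p t = (\<Sum>j<t. t div p ^ j mod p)"

definition R_set :: "nat \<Rightarrow> (rat ^ 'm) set" where
  "R_set p = {r. \<forall>i. 0 \<le> rat_ord p (r $ i) \<and> -1 \<le> r $ i \<and> r $ i \<le> 0}"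

definition period :: "nat \<Rightarrow> rat ^ 'm \<Rightarrow> nat" where
  "period p r = (SOME a. a > 0 \<and> (\<forall>i. (1 - of_nat p ^ a) * r $ i \<in> \<nat>))"

definition weight :: "nat \<Rightarrow> rat ^ 'm::finite \<Rightarrow> real" where
  "weight p r =
     real (\<Sum>i\<in>UNIV. digit_weight p (nat \<lfloor>(1 - of_nat p ^ period p r) * r $ i\<rfloor>)) /
     real (period p r)"

definition R_fiber :: "nat \<Rightarrow> ('m::finite \<Rightarrow> int ^ 'n) \<Rightarrow> rat ^ 'n \<Rightarrow> (rat ^ 'm) set" where
  "R_fiber p a \<beta> = {r \<in> R_set p. (\<Sum>i\<in>UNIV. r $ i *s vec_of_int (a i)) = \<beta>}"

definition min_weight :: "nat \<Rightarrow> ('m::finite \<Rightarrow> int ^ 'n) \<Rightarrow> rat ^ 'n \<Rightarrow> real" where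
  "min_weight p a \<beta> = Inf (weight p ` R_fiber p a \<beta>)"

end

theory Submission
  imports Defs "HOL-Number_Theory.Residues"
begin

no_notation fps_nth (infixl \<open>$\<close> 75)

text \<open>
  Choose \<open>K > 0\<close> such that \<open>V = (1 - p ^ K) v\<close> and \<open>s = (1 - p ^ K) r\<close> have natural number entries,
  where \<open>v\<close> and \<open>r\<close> lie in the same fibre. Then \<open>l = s - V\<close> belongs to \<open>L_v\<close>. By the identity
  \<open>w_p (t + 1) + (p - 1) ord_p (t + 1) = w_p t + 1\<close>, the coefficient at \<open>l\<close> has order
  \<open>(w_p s - w_p V) / (p - 1) = K (w r - w v) / (p - 1)\<close>. Conversely, for every \<open>l\<close> in \<open>L_v\<close> and every
  large suitable \<open>K\<close> the vector \<open>r = v + l / (1 - p ^ K)\<close> lies in the fibre of \<open>v\<close>. So the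
  coefficients are integral if \<open>w v\<close> is minimal. If some \<open>r\<close> in the fibre has \<open>w r < w v\<close>, keeping
  \<open>r\<close> fixed and letting \<open>K\<close> grow makes the orders tend to \<open>-\<infinity>\<close>.
\<close>

section \<open>Digit sums\<close>

lemma less_prime_power:
  assumes "(p::nat) \<ge> 2"
  shows "n < p ^ n"
  using less_exp[of n] power_mono[OF assms, of n] by linarith

lemma digit_weight_rec:
  assumes "p \<ge> 2"
  shows "digit_weight p t = t mod p + digit_weight p (t div p)"
proof (cases "t = 0")
  case False
  \<comment> \<open>The digit at place \<open>t\<close> is zero, so the sum may be lengthened by one
    term; the shift below then splits off the lowest digit.\<close>
  have "t div p ^ t = 0" using less_prime_power[OF assms, of t] by simp
  then have "digit_weight p t = (\<Sum>j<Suc t. t div p ^ j mod p)"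
    by (simp add: digit_weight_def)
  also have "\<dots> = t mod p + (\<Sum>j<t. t div p div p ^ j mod p)"
    by (subst sum.lessThan_Suc_shift) (simp add: div_mult2_eq)
  \<comment> \<open>The recursion needs the cutoff \<open>t div p\<close> instead of
    \<open>t\<close>; the digits dropped in between are zero.\<close>
  also have "(\<Sum>j<t. t div p div p ^ j mod p) = (\<Sum>j<t div p. t div p div p ^ j mod p)"
  proof (rule sum.mono_neutral_right)
    show "\<forall>i\<in>{..<t} - {..<t div p}. t div p div p ^ i mod p = 0"
    proof
      fix j assume "j \<in> {..<t} - {..<t div p}"
      then have "t div p < p ^ j" using less_prime_power[OF assms, of j] by auto
      then show "t div p div p ^ j mod p = 0" by simp
    qed
  qed (use assms in auto)
  finally show ?thesis by (simp add: digit_weight_def)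
qed (simp add: digit_weight_def)

text \<open>The digits of \<open>t\<close>, padded to \<open>k\<close> places, are followed by those
  of \<open>u\<close>, so no carry occurs.\<close>

lemma digit_weight_concat:
  assumes "p \<ge> 2" and "t < p ^ k"
  shows "digit_weight p (t + p ^ k * u) = digit_weight p t + digit_weight p u"
  using assms(2)
proof (induction k arbitrary: t)
  case 0
  then show ?case by (simp add: digit_weight_def)
next
  case (Suc k)
  have d: "(t + p ^ Suc k * u) div p = t div p + p ^ k * u"
    and m: "(t + p ^ Suc k * u) mod p = t mod p"
    using assms(1) by (simp_all add: mult.assoc)
  have "t div p < p ^ k" using Suc.prems assms(1) by (simp add: less_mult_imp_div_less mult.commute)
  then show ?case
    using Suc.IH[of "t div p"] digit_weight_rec[OF assms(1), of t]
      digit_weight_rec[OF assms(1), of "t + p ^ Suc k * u"]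
    unfolding d m by linarith
qed

text \<open>Adding 1 to \<open>s\<close> turns its trailing digits \<open>p - 1\<close> into 0 and
  raises the next digit by 1; the number of these trailing digits is the multiplicity of
  \<open>p\<close> in \<open>Suc s\<close>. The induction removes one of them at a time.\<close>

lemma digit_weight_Suc:
  assumes "prime p"
  shows "digit_weight p (Suc s) + (p - 1) * multiplicity (int p) (int (Suc s)) = digit_weight p s + 1"
proof (induction s rule: less_induct)
  case (less s)
  have p2: "p \<ge> 2" using assms by (rule prime_ge_2_nat)
  show ?case
  proof (cases "p dvd Suc s")
    case False
    then have "multiplicity (int p) (int (Suc s)) = 0"
      by (intro not_dvd_imp_multiplicity_0) (metis int_dvd_int_iff)
    moreover from False have "Suc s mod p = Suc (s mod p)" "Suc s div p = s div p"
      by (auto simp: mod_Suc div_Suc dvd_eq_mod_eq_0 split: if_splits)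
    ultimately show ?thesis
      using digit_weight_rec[OF p2, of s] digit_weight_rec[OF p2, of "Suc s"] by simp
  next
    case True
    then obtain q where q: "Suc s = p * q" by blast
    then obtain q' where q': "q = Suc q'" by (cases q) auto
    have s: "s = (p - 1) + p * q'" using q q' p2 by (simp add: algebra_simps)
    have "s mod p = p - 1" unfolding s mod_mult_self2 using p2 by simp
    moreover have "s div p = q'"
      unfolding s by (subst div_mult_self2) (use p2 in auto)
    ultimately have ws: "digit_weight p s = p - 1 + digit_weight p q'"
      using digit_weight_rec[OF p2, of s] by simp
    have wS: "digit_weight p (Suc s) = digit_weight p (Suc q')"
      using digit_weight_rec[OF p2, of "Suc s"] p2 q q' by simp
    have "multiplicity (int p) (int (Suc s)) = Suc (multiplicity (int p) (int (Suc q')))"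
      unfolding q q' of_nat_mult using p2 assms
      by (intro multiplicity_times_same) auto
    moreover have "2 * q' \<le> p * q'" using p2 by (rule mult_le_mono1)
    then have "q' < s" using s p2 by linarith
    ultimately show ?thesis using less.IH[of q'] ws wS by (simp add: algebra_simps)
  qed
qed

text \<open>Telescoping \<open>digit_weight_Suc\<close> gives Legendre's formula for
  \<open>(s + m)! / s!\<close>.\<close>

lemma digit_weight_add:
  assumes "prime p"
  shows "real (p - 1) * real (\<Sum>j=1..m. multiplicity (int p) (int (s + j)))
           = real m + real (digit_weight p s) - real (digit_weight p (s + m))"
proof (induction m)
  case (Suc m)
  have "real (digit_weight p (Suc (s + m)))
      + real (p - 1) * real (multiplicity (int p) (int (Suc (s + m))))
     = real (digit_weight p (s + m)) + 1"
    using arg_cong[OF digit_weight_Suc[OF assms, of "s + m"], of real]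
    by (simp only: of_nat_add of_nat_mult of_nat_1)
  then show ?case using Suc.IH by (simp add: algebra_simps)
qed simp


section \<open>Periodic expansions and the weight\<close>

text \<open>
  If \<open>(1 - p ^ K) r = t\<close> then \<open>r = t + p ^ K t + p ^ (2 K) t + \<dots>\<close>, so \<open>t\<close> collects the first \<open>K\<close>
  digits of the periodic \<open>p\<close>-adic expansion of \<open>r\<close>.
\<close>

definition truncation :: "nat \<Rightarrow> nat \<Rightarrow> rat ^ 'm \<Rightarrow> ('m \<Rightarrow> nat) \<Rightarrow> bool" where
  "truncation p K r t \<longleftrightarrow> K > 0 \<and> (\<forall>i. (1 - of_nat p ^ K) * r $ i = of_nat (t i))"

text \<open>The bound \<open>- 1 \<le> r $ i\<close> gives \<open>t i \<le> p ^ K - 1\<close>. Hence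
  \<open>t i\<close> fits into \<open>K\<close> digits, as concatenation of blocks requires.\<close>

lemma truncation_less:
  assumes "p \<ge> 2" and "r \<in> R_set p" and "truncation p K r t"
  shows "t i < p ^ K"
proof -
  have "(1::rat) \<le> of_nat p ^ K" using assms(1) by (intro one_le_power) simp
  moreover have "- 1 \<le> r $ i" using assms(2) by (auto simp: R_set_def)
  ultimately have "(1 - of_nat p ^ K) * r $ i \<le> (1 - of_nat p ^ K) * (- 1)"
    by (intro mult_left_mono_neg) auto
  also have "\<dots> < of_nat p ^ K" by simp
  finally have "rat_of_nat (t i) < of_nat p ^ K" using assms(3) by (simp add: truncation_def)
  then show ?thesis by (metis of_nat_less_iff of_nat_power)
qed

text \<open>The base \<open>p\<close> expansion of \<open>t'\<close> consists of \<open>m\<close>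
  copies of the \<open>K\<close>-digit block of \<open>t\<close>, and digit sums of blocks
  add.\<close>

lemma truncation_mult:
  fixes r :: "rat ^ 'm::finite"
  assumes p: "p \<ge> 2" and r: "r \<in> R_set p" and t: "truncation p K r t" and "m > 0"
  obtains t' where "truncation p (K * m) r t'"
    and "(\<Sum>i\<in>UNIV. digit_weight p (t' i)) = m * (\<Sum>i\<in>UNIV. digit_weight p (t i))"
proof -
  have "\<exists>t'. truncation p (K * Suc n) r t' \<and>
      (\<Sum>i\<in>UNIV. digit_weight p (t' i)) = Suc n * (\<Sum>i\<in>UNIV. digit_weight p (t i))" for n
  proof (induction n)
    case 0
    then show ?case using t by auto
  next
    case (Suc n)
    then obtain u where u: "truncation p (K * Suc n) r u"
      and wu: "(\<Sum>i\<in>UNIV. digit_weight p (u i)) = Suc n * (\<Sum>i\<in>UNIV. digit_weight p (t i))"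
      by blast
    \<comment> \<open>One more block is placed below the \<open>Suc n\<close> blocks of
      \<open>u\<close>.\<close>
    let ?t = "\<lambda>i. t i + p ^ K * u i"
    have "(1 - of_nat p ^ (K * Suc (Suc n))) * r $ i = of_nat (?t i)" for i
    proof -
      have "(1 - of_nat p ^ (K * Suc (Suc n))) * r $ i =
        (1 - of_nat p ^ K) * r $ i + of_nat p ^ K * ((1 - of_nat p ^ (K * Suc n)) * r $ i)"
        by (simp add: algebra_simps power_add)
      then show ?thesis using t u by (simp add: truncation_def)
    qed
    then have "truncation p (K * Suc (Suc n)) r ?t"
      using t by (simp add: truncation_def)
    moreover have "(\<Sum>i\<in>UNIV. digit_weight p (?t i)) = Suc (Suc n) * (\<Sum>i\<in>UNIV. digit_weight p (t i))"
      using wu by (simp add: digit_weight_concat[OF p truncation_less[OF p r t]] sum.distrib)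
    ultimately show ?case by blast
  qed
  from this[of "m - 1"] that \<open>m > 0\<close> show thesis by auto
qed

lemma truncation_unique:
  assumes "truncation p K r t" and "truncation p K r t'"
  shows "t = t'"
proof
  fix i
  have "of_nat (t i) = (of_nat (t' i) :: rat)"
    using assms by (simp add: truncation_def)
  then show "t i = t' i" by (simp only: of_nat_eq_iff)
qed

section \<open>Existence of periods, and independence of the weight from the chosen period\<close>

lemma coprime_denominator:
  assumes "prime p" and "0 \<le> rat_ord p x"
  shows "coprime (int p) (snd (quotient_of x))"
proof (rule ccontr)
  obtain n d where nd: "quotient_of x = (n, d)" by (cases "quotient_of x")
  have pp: "prime (int p)" using assms(1) by simp
  assume "\<not> coprime (int p) (snd (quotient_of x))"
  then have pd: "int p dvd d" using prime_imp_coprime[OF pp] nd by auto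
  then have "\<not> int p dvd n"
    using quotient_of_coprime[OF nd] pp by (meson coprime_common_divisor not_prime_unit)
  then have "multiplicity (int p) n = 0" by (rule not_dvd_imp_multiplicity_0)
  moreover have "d > 0" using nd by (rule quotient_of_denom_pos)
  then have "multiplicity (int p) d \<ge> 1" using pd pp by (intro multiplicity_geI) auto
  moreover have "x \<noteq> 0" using pd pp nd by auto
  ultimately show False using assms(2) nd by (simp add: rat_ord_def)
qed

text \<open>All denominators divide their product \<open>D\<close>, which is prime to
  \<open>p\<close>; by Euler's theorem they divide \<open>p ^ totient D - 1\<close>.\<close>

lemma period_exists:
  fixes r :: "rat ^ 'm::finite"
  assumes "prime p" and r: "r \<in> R_set p"
  shows "\<exists>a. a > 0 \<and> (\<forall>i. (1 - of_nat p ^ a) * r $ i \<in> \<nat>)"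
proof -
  define d where "d = (\<lambda>i. nat (snd (quotient_of (r $ i))))"
  have int_d: "int (d i) = snd (quotient_of (r $ i))" for i
    using quotient_of_denom_pos'[of "r $ i"] by (simp add: d_def)
  define D where "D = (\<Prod>i\<in>UNIV. d i)"
  have "coprime p (d i)" for i
    using coprime_denominator[OF assms(1), of "r $ i"] r unfolding int_d[symmetric]
    by (simp add: R_set_def)
  then have "coprime p D" unfolding D_def by (intro prod_coprime_right) auto
  then have cong: "[p ^ totient D = 1] (mod D)" by (rule euler_theorem)
  have dpos: "d i > 0" for i using quotient_of_denom_pos'[of "r $ i"] int_d[of i] by linarith
  then have "D > 0" unfolding D_def by (intro prod_pos) auto
  then have a: "totient D > 0" by simp
  have p1: "p ^ totient D \<ge> 1" using prime_gt_0_nat[OF assms(1)] by simp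
  have "(1 - of_nat p ^ totient D) * r $ i \<in> \<nat>" for i
  proof -
    have "d i dvd D" unfolding D_def by (intro dvd_prodI) auto
    then have "d i dvd p ^ totient D - 1"
      using cong p1 by (metis cong_altdef_nat dvd_trans cong_sym)
    then obtain k where k: "p ^ totient D - 1 = d i * k" by blast
    have "r $ i = of_int (fst (quotient_of (r $ i))) / of_int (int (d i))"
      unfolding int_d by (rule quotient_of_div) simp
    then have ri: "r $ i * of_nat (d i) = of_int (fst (quotient_of (r $ i)))"
      using dpos[of i] by (simp add: field_simps)
    have "(of_nat p ^ totient D :: rat) - 1 = of_nat (p ^ totient D - 1)"
      using p1 by (simp add: of_nat_diff)
    also have "\<dots> = of_nat (d i) * of_nat k" unfolding k by simp
    finally have e: "(1 - of_nat p ^ totient D) * r $ i = - (of_nat k * (r $ i * of_nat (d i)))"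
      by (simp add: algebra_simps)
    have "(1 - of_nat p ^ totient D) * r $ i \<in> \<int>" unfolding e ri by simp
    \<comment> \<open>Both factors are nonpositive, so the integer just found is a natural
      number.\<close>
    moreover have "(1::rat) \<le> of_nat p ^ totient D"
      using p1 by (metis of_nat_1 of_nat_le_iff of_nat_power)
    then have "(1 - of_nat p ^ totient D) * r $ i \<ge> 0"
      using r by (intro mult_nonpos_nonpos) (auto simp: R_set_def)
    ultimately show ?thesis by (simp add: Nats_altdef2)
  qed
  with a show ?thesis by blast
qed

lemma truncation_period:
  fixes r :: "rat ^ 'm::finite"
  assumes "prime p" and "r \<in> R_set p"
  obtains t where "truncation p (period p r) r t"
    and "weight p r * real (period p r) = real (\<Sum>i\<in>UNIV. digit_weight p (t i))"
proof -
  let ?t = "\<lambda>i. nat \<lfloor>(1 - of_nat p ^ period p r) * r $ i\<rfloor>"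
  have P: "period p r > 0 \<and> (\<forall>i. (1 - of_nat p ^ period p r) * r $ i \<in> \<nat>)"
    unfolding period_def by (rule someI_ex) (rule period_exists[OF assms])
  have "(1 - of_nat p ^ period p r) * r $ i = of_nat (?t i)" for i
  proof -
    obtain n where n: "(1 - of_nat p ^ period p r) * r $ i = of_nat n" using P by (metis Nats_cases)
    show ?thesis unfolding n by simp
  qed
  then have "truncation p (period p r) r ?t" using P by (simp add: truncation_def)
  moreover have "weight p r * real (period p r) = real (\<Sum>i\<in>UNIV. digit_weight p (?t i))"
    using P by (simp add: weight_def)
  ultimately show thesis using that by blast
qed

text \<open>Any truncation computes the weight, not only the one at the chosen period: repeating the
  blocks of both up to the common length \<open>K * period p r\<close> gives the same
  vector.\<close>

lemma weight_truncation:
  fixes r :: "rat ^ 'm::finite"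
  assumes "prime p" and r: "r \<in> R_set p" and t: "truncation p K r t"
  shows "weight p r * real K = real (\<Sum>i\<in>UNIV. digit_weight p (t i))"
proof -
  have p: "p \<ge> 2" using assms(1) by (rule prime_ge_2_nat)
  obtain s where s: "truncation p (period p r) r s"
    and ws: "weight p r * real (period p r) = real (\<Sum>i\<in>UNIV. digit_weight p (s i))"
    using truncation_period[OF assms(1) r] .
  have K: "K > 0" and P: "period p r > 0" using s t by (auto simp: truncation_def)
  obtain s' where s': "truncation p (period p r * K) r s'"
    and ws': "(\<Sum>i\<in>UNIV. digit_weight p (s' i)) = K * (\<Sum>i\<in>UNIV. digit_weight p (s i))"
    using truncation_mult[OF p r s K] .
  obtain t' where t': "truncation p (K * period p r) r t'"
    and wt': "(\<Sum>i\<in>UNIV. digit_weight p (t' i)) = period p r * (\<Sum>i\<in>UNIV. digit_weight p (t i))"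
    using truncation_mult[OF p r t P] .
  have "s' = t'" using s' t' by (intro truncation_unique) (simp_all add: mult.commute)
  then have "real (period p r) * real (\<Sum>i\<in>UNIV. digit_weight p (t i)) =
      real K * (weight p r * real (period p r))"
    using ws ws' wt' by (metis of_nat_mult)
  then show ?thesis using P by simp
qed

lemma weight_nonneg: "0 \<le> weight p r"
  by (simp add: weight_def sum_nonneg)

lemma period_pos:
  assumes "prime p" and "r \<in> R_set p"
  shows "period p (r :: rat ^ 'm::finite) > 0"
  using truncation_period[OF assms] by (auto simp: truncation_def)

lemma truncation_exists:
  fixes r :: "rat ^ 'm::finite"
  assumes "prime p" and "r \<in> R_set p" and "K > 0" and "period p r dvd K"
  obtains t where "truncation p K r t"
proof -
  obtain s where "truncation p (period p r) r s" using truncation_period[OF assms(1,2)] .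
  moreover obtain m where "K = period p r * m" "m > 0" using assms(3,4) by (auto elim!: dvdE)
  ultimately show thesis
    using truncation_mult[OF prime_ge_2_nat[OF assms(1)] assms(2)] that by metis
qed


section \<open>The order of the coefficients\<close>

context padic_alg_closure
begin

section \<open>Arithmetic of the valuation\<close>

lemma ord_1: "ord 1 = 0"
  using ord_of_rat[of 1] by (simp add: rat_ord_def zero_ereal_def)

lemma ord_of_int:
  "ord (of_int n) = (if n = 0 then \<infinity> else ereal (real (multiplicity (int p) n)))"
proof -
  have "quotient_of (of_int n) = (n, 1)"
    using quotient_of_int[of n] by (simp add: Rat.of_int_def)
  then show ?thesis using ord_of_rat[of "of_int n"] by (simp add: rat_ord_def)
qed

lemma ord_minus: "ord (- x) = ord x"
  using ord_mult[of "- 1" x] ord_of_int[of "- 1"] by (simp add: zero_ereal_def[symmetric])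

lemma ord_add_eq:
  assumes "ord x < ord y"
  shows "ord (x + y) = ord x"
proof (rule antisym)
  show "ord x \<le> ord (x + y)" using ord_add[of x y] assms by (simp add: min_def split: if_splits)
  \<comment> \<open>Since \<open>x = (x + y) + (- y)\<close> and \<open>ord y\<close> exceeds
    \<open>ord x\<close>, the minimum must be \<open>ord (x + y)\<close>.\<close>
  have "min (ord (x + y)) (ord y) \<le> ord x" using ord_add[of "x + y" "- y"] by (simp add: ord_minus)
  then show "ord (x + y) \<le> ord x" using assms by (auto simp: min_def split: if_splits)
qed

lemma ord_real:
  assumes "x \<noteq> 0"
  obtains y where "ord x = ereal y"
  using assms ord_eq_infinity_iff[of x] ord_not_minus_infinity[of x] by (cases "ord x") auto

lemma ord_nonzero: "ord x = ereal y \<Longrightarrow> x \<noteq> 0"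
  using ord_eq_infinity_iff[of x] by auto

lemma ord_inverse:
  assumes "ord x = ereal y"
  shows "ord (inverse x) = ereal (- y)"
proof -
  have x: "x \<noteq> 0" using assms by (rule ord_nonzero)
  then obtain z where z: "ord (inverse x) = ereal z" using ord_real[of "inverse x"] by auto
  have "ereal y + ereal z = 0"
    using ord_mult[of x "inverse x"] ord_1 x assms z by simp
  then show ?thesis using z by (simp add: zero_ereal_def)
qed

lemma ord_power:
  assumes "ord x = ereal y"
  shows "ord (x ^ n) = ereal (real n * y)"
  by (induction n) (simp_all add: assms ord_1 ord_mult zero_ereal_def algebra_simps)

lemma ord_power_int:
  assumes "ord x = ereal y"
  shows "ord (x powi n) = ereal (of_int n * y)"
proof (cases "n \<ge> 0")
  case True
  then show ?thesis using ord_power[OF assms, of "nat n"] by (simp add: power_int_def)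
next
  case False
  then show ?thesis
    using ord_power[OF ord_inverse[OF assms], of "nat (- n)"] by (simp add: power_int_def)
qed

lemma ord_prod:
  assumes "\<And>i. i \<in> A \<Longrightarrow> ord (f i) = ereal (g i)"
  shows "ord (prod f A) = ereal (sum g A)"
  using assms by (induction A rule: infinite_finite_induct) (simp_all add: ord_1 ord_mult zero_ereal_def)

lemma ord_uniformizer:
  assumes "prime p" and "\<pi> ^ (p - 1) = - of_nat p"
  shows "ord \<pi> = ereal (1 / real (p - 1))"
proof -
  have p: "p - 1 > 0" using prime_gt_1_nat[OF assms(1)] by simp
  have "ord (of_int (int p)) = ereal 1"
    using ord_of_int[of "int p"] prime_gt_0_nat[OF assms(1)] assms(1)
    by (simp add: one_ereal_def prime_imp_prime_elem)
  then have e: "ord (\<pi> ^ (p - 1)) = ereal 1" using assms(2) by (simp add: ord_minus)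
  then have "\<pi> ^ (p - 1) \<noteq> 0" by (rule ord_nonzero)
  then have "\<pi> \<noteq> 0" using p by auto
  then obtain y where y: "ord \<pi> = ereal y" using ord_real by blast
  have "real (p - 1) * y = 1" using e ord_power[OF y, of "p - 1"] by (metis ereal.inject)
  then have "y = 1 / real (p - 1)"
    using p by (metis nonzero_mult_div_cancel_left of_nat_0_less_iff less_irrefl)
  then show ?thesis using y by simp
qed

text \<open>
  Replacing the rational \<open>x\<close> by its truncation \<open>V\<close> changes \<open>x + j\<close> by \<open>p ^ K x\<close>, which has larger
  order than the integer \<open>z = V + j\<close> as soon as \<open>0 < z < p ^ K\<close>.
\<close>

lemma ord_shift:
  assumes "prime p" and x: "0 \<le> rat_ord p x" and V: "(1 - of_nat p ^ K) * x = of_nat V"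
    and z: "0 < z" "z < p ^ K"
  shows "ord (of_rat (x + of_nat z - of_nat V)) = ereal (real (multiplicity (int p) (int z)))"
proof -
  have pp: "prime (int p)" using assms(1) by simp
  have "multiplicity (int p) (int z) < K"
  proof (rule ccontr)
    assume "\<not> ?thesis"
    then have "int p ^ K dvd int z" by (intro multiplicity_dvd') auto
    then have "int p ^ K \<le> int z" using z by (intro zdvd_imp_le) auto
    then show False using z by (metis not_less of_nat_le_iff of_nat_power)
  qed
  moreover have oz: "ord (of_nat z) = ereal (real (multiplicity (int p) (int z)))"
    using ord_of_int[of "int z"] z by simp
  moreover have "ord (of_nat p) = ereal 1"
    using ord_of_int[of "int p"] pp prime_gt_0_nat[OF assms(1)]
    by (simp add: one_ereal_def prime_imp_prime_elem)
  then have "ord (of_nat p ^ K) = ereal (real K)" using ord_power by fastforce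
  then have "ereal (real K) \<le> ord (of_nat p ^ K * of_rat x)"
    using x add_left_mono[of 0 "rat_ord p x" "ereal (real K)"] by (simp add: ord_mult ord_of_rat)
  ultimately have "ord (of_nat z) < ord (of_nat p ^ K * of_rat x)"
    by (metis ereal_less_eq(3) less_ereal.simps(1) of_nat_less_iff order_less_le_trans)
  from ord_add_eq[OF this] oz
  have "ord (of_nat z + of_nat p ^ K * of_rat x) = ereal (real (multiplicity (int p) (int z)))"
    by simp
  moreover have "x + of_nat z - of_nat V = of_nat z + of_nat p ^ K * x"
    unfolding V[symmetric] by (simp add: algebra_simps)
  then have "of_rat (x + of_nat z - of_nat V) = (of_nat z + of_nat p ^ K * of_rat x :: 'k)"
    by (simp only: of_rat_add of_rat_mult of_rat_power of_rat_of_nat_eq)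
  ultimately show ?thesis by simp
qed

text \<open>Each factor has the order of the integer \<open>s + j\<close>, which stays below
  \<open>p ^ K\<close>, so the digit-sum form of Legendre's formula applies.\<close>

lemma ord_prod_shift:
  assumes "prime p" and "0 \<le> rat_ord p x" and "(1 - of_nat p ^ K) * x = of_nat V"
    and "s + m < p ^ K"
  shows "ord (of_rat (\<Prod>j=1..m. x + of_nat (s + j) - of_nat V)) =
    ereal ((real m + real (digit_weight p s) - real (digit_weight p (s + m))) / real (p - 1))"
proof -
  have "ord (\<Prod>j=1..m. of_rat (x + of_nat (s + j) - of_nat V)) =
      ereal (\<Sum>j=1..m. real (multiplicity (int p) (int (s + j))))"
  proof (rule ord_prod)
    fix j assume j: "j \<in> {1..m}"
    show "ord (of_rat (x + of_nat (s + j) - of_nat V)) =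
        ereal (real (multiplicity (int p) (int (s + j))))"
      by (rule ord_shift[OF assms(1-3)]) (use j assms(4) in auto)
  qed
  moreover have "(\<Sum>j=1..m. real (multiplicity (int p) (int (s + j)))) =
      (real m + real (digit_weight p s) - real (digit_weight p (s + m))) / real (p - 1)"
    using digit_weight_add[OF assms(1), where m = m and s = s] prime_gt_1_nat[OF assms(1)]
    by (simp add: field_simps)
  ultimately show ?thesis by (simp add: of_rat_prod)
qed

text \<open>Contribution of one coordinate, with \<open>n\<close> in the role of
  \<open>l $ i\<close>. One of the two products is empty, according to the sign of \<open>n\<close>.
  The summand \<open>- n / (p - 1)\<close> will cancel against the power of \<pi>.\<close>

lemma ord_factor:
  assumes "prime p" and "0 \<le> rat_ord p x" and "(1 - of_nat p ^ K) * x = of_nat V"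
    and s: "int s = int V + n" and less: "V < p ^ K" "s < p ^ K"
  shows "ord (of_rat ((\<Prod>j=1..nat (- n). x - of_nat j + 1) / (\<Prod>j=1..nat n. x + of_nat j))) =
    ereal ((real (digit_weight p s) - real (digit_weight p V) - of_int n) / real (p - 1))"
proof (cases "n \<ge> 0")
  case True
  have sV: "s = V + nat n" using s True by auto
  have "ord (of_rat (\<Prod>j=1..nat n. x + of_nat j)) =
    ereal ((real (nat n) + real (digit_weight p V) - real (digit_weight p s)) / real (p - 1))"
    using ord_prod_shift[OF assms(1-3), of V "nat n"] less sV by (simp add: add.assoc)
  from ord_inverse[OF this] show ?thesis
    using True by (simp add: of_rat_inverse inverse_eq_divide[symmetric] minus_divide_left algebra_simps)
next
  case False
  define m where "m = nat (- n)"
  have V: "V = s + m" using s False by (auto simp: m_def)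
  \<comment> \<open>Replacing \<open>j\<close> by \<open>m + 1 - j\<close> gives the factor
    \<open>x - m + j\<close>, and \<open>m = V - s\<close>.\<close>
  have "(\<Prod>j=1..m. x - of_nat j + 1) = (\<Prod>j=1..m. x + of_nat (s + j) - of_nat V)"
    by (subst prod.atLeastAtMost_rev) (rule prod.cong, auto simp: V of_nat_diff)
  then have "ord (of_rat (\<Prod>j=1..m. x - of_nat j + 1)) =
    ereal ((real m + real (digit_weight p s) - real (digit_weight p V)) / real (p - 1))"
    using ord_prod_shift[OF assms(1-3), of s m] less V by simp
  then show ?thesis using False by (simp add: m_def algebra_simps)
qed

lemma ord_Phi_coeff:
  fixes v r :: "rat ^ 'm::finite" and l :: "int ^ 'm"
  assumes "prime p" and "\<pi> ^ (p - 1) = - of_nat p"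
    and v: "v \<in> R_set p" "truncation p K v V" and r: "r \<in> R_set p" "truncation p K r s"
    and l: "\<And>i. l $ i = int (s i) - int (V i)"
  shows "ord (Phi_coeff \<pi> v l) = ereal (real K * (weight p r - weight p v) / real (p - 1))"
proof -
  have p: "p \<ge> 2" using assms(1) by (rule prime_ge_2_nat)
  let ?f = "\<lambda>i. (\<Prod>j=1..nat (- (l $ i)). v $ i - of_nat j + 1) / (\<Prod>j=1..nat (l $ i). v $ i + of_nat j)"
  let ?g = "\<lambda>i. (real (digit_weight p (s i)) - real (digit_weight p (V i)) - of_int (l $ i)) / real (p - 1)"
  \<comment> \<open>Coordinates of the wrong sign contribute empty products, so both brackets may
    run over all coordinates and combine into one product.\<close>
  have "bracket_minus v l = (\<Prod>i\<in>UNIV. \<Prod>j=1..nat (- (l $ i)). v $ i - of_nat j + 1)"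
    unfolding bracket_minus_def by (rule prod.mono_neutral_left) auto
  moreover have "bracket_plus v l = (\<Prod>i\<in>UNIV. \<Prod>j=1..nat (l $ i). v $ i + of_nat j)"
    unfolding bracket_plus_def by (rule prod.mono_neutral_left) auto
  ultimately have q: "bracket_minus v l / bracket_plus v l = (\<Prod>i\<in>UNIV. ?f i)"
    by (simp add: prod_dividef)
  have "ord (\<Prod>i\<in>UNIV. of_rat (?f i)) = ereal (\<Sum>i\<in>UNIV. ?g i)"
  proof (rule ord_prod)
    fix i
    show "ord (of_rat (?f i)) = ereal (?g i)"
      by (rule ord_factor[OF assms(1), of _ K])
        (use v r l truncation_less[OF p v] truncation_less[OF p r] in
          \<open>auto simp: R_set_def truncation_def\<close>)
  qed
  then have "ord (Phi_coeff \<pi> v l) =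
      ereal ((\<Sum>i\<in>UNIV. ?g i) + of_int (\<Sum>i\<in>UNIV. l $ i) * (1 / real (p - 1)))"
    unfolding Phi_coeff_def q
    by (simp add: ord_mult of_rat_prod ord_power_int[OF ord_uniformizer[OF assms(1,2)]])
  \<comment> \<open>Each factor \<pi> has order \<open>1 / (p - 1)\<close>, so the terms linear in
    \<open>l\<close> cancel and only digit sums remain.\<close>
  also have "(\<Sum>i\<in>UNIV. ?g i) + of_int (\<Sum>i\<in>UNIV. l $ i) * (1 / real (p - 1)) =
     (real (\<Sum>i\<in>UNIV. digit_weight p (s i)) - real (\<Sum>i\<in>UNIV. digit_weight p (V i))) / real (p - 1)"
    by (simp add: sum_divide_distrib[symmetric] sum_subtractf diff_divide_distrib)
  also have "\<dots> = real K * (weight p r - weight p v) / real (p - 1)"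
    unfolding weight_truncation[OF assms(1) v, symmetric] weight_truncation[OF assms(1) r, symmetric]
    by (simp add: algebra_simps)
  finally show ?thesis .
qed

text \<open>\<open>1 - p ^ K\<close> is a \<open>p\<close>-adic unit, so \<open>x\<close> has the
  order of the natural number \<open>s\<close>. This gives \<open>p\<close>-integrality of vectors
  built from prescribed truncations.\<close>

lemma rat_ord_nonneg_of_truncation:
  assumes "prime p" and "K > 0" and "(1 - of_nat p ^ K) * x = of_nat s"
  shows "0 \<le> rat_ord p x"
proof -
  have "\<not> int p dvd 1 - int p ^ K"
    using assms(1,2) prime_gt_1_nat[OF assms(1)]
    by (simp add: dvd_diff_left_iff)
  then have "ord (of_int (1 - int p ^ K)) = 0"
    unfolding ord_of_int by (auto simp: not_dvd_imp_multiplicity_0 zero_ereal_def)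
  moreover have "of_int (1 - int p ^ K) * of_rat x = (of_nat s :: 'k)"
    using arg_cong[OF assms(3), of "of_rat :: rat \<Rightarrow> 'k"]
    by (simp add: of_rat_mult of_rat_diff of_rat_power)
  ultimately have "ord (of_rat x) = ord (of_nat s)"
    using ord_mult[of "of_int (1 - int p ^ K)" "of_rat x"] by simp
  then show ?thesis using ord_of_int[of "int s"] by (simp add: ord_of_rat split: if_splits)
qed

end


section \<open>Lattice points as differences of truncations\<close>

text \<open>With \<open>q = p ^ K\<close>, the shifted truncation must again lie between 0 and
  \<open>q - 1\<close>. For \<open>x\<close> strictly inside the interval, the distances of
  \<open>(1 - q) * x\<close> to both ends grow linearly in \<open>q\<close>; at an endpoint one
  distance is 0, and the sign condition on \<open>n\<close> takes over.\<close>

lemma interval_shift: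
  fixes x :: rat and n :: int
  assumes "- 1 \<le> x" "x \<le> 0" and "x = 0 \<Longrightarrow> 0 \<le> n" and "x = - 1 \<Longrightarrow> n \<le> 0"
  shows "\<exists>C::nat. \<forall>q\<ge>C. 0 \<le> (1 - of_nat q) * x + of_int n \<and>
           (1 - of_nat q) * x + of_int n \<le> of_nat q - 1"
proof -
  consider "x = 0" | "x = - 1" | "- 1 < x" "x < 0" using assms(1,2) by linarith
  then show ?thesis
  proof cases
    case 1
    show ?thesis
    proof (intro exI[of _ "nat n + 1"] allI impI)
      fix q :: nat assume "nat n + 1 \<le> q"
      then have "of_int n \<le> (of_int (int q - 1) :: rat)" unfolding of_int_le_iff by linarith
      then show "0 \<le> (1 - of_nat q) * x + of_int n \<and> (1 - of_nat q) * x + of_int n \<le> of_nat q - 1"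
        using 1 assms(3) by simp
    qed
  next
    case 2
    show ?thesis
    proof (intro exI[of _ "nat (1 - n)"] allI impI)
      fix q :: nat assume "nat (1 - n) \<le> q"
      then have "of_int (1 - n) \<le> (of_int (int q) :: rat)" unfolding of_int_le_iff by linarith
      moreover have "(of_int n :: rat) \<le> 0" using 2 assms(4) by simp
      ultimately show "0 \<le> (1 - of_nat q) * x + of_int n \<and> (1 - of_nat q) * x + of_int n \<le> of_nat q - 1"
        using 2 by simp
    qed
  next
    case 3
    \<comment> \<open>The two distances are \<open>(q - 1) * (- x)\<close> and
      \<open>(q - 1) * (1 + x)\<close>; \<open>C\<close> makes both at least
      \<open>\<bar>n\<bar>\<close>.\<close>
    obtain C where C: "1 + \<bar>of_int n\<bar> / (- x) + \<bar>of_int n\<bar> / (1 + x) \<le> (of_nat C :: rat)"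
      using real_arch_simple by blast
    show ?thesis
    proof (intro exI[of _ C] allI impI)
      fix q :: nat assume "C \<le> q"
      then have "(of_nat C :: rat) \<le> of_nat q" by simp
      moreover have "0 \<le> \<bar>of_int n\<bar> / (- x)" "0 \<le> \<bar>of_int n\<bar> / (1 + x)"
        using 3 by (auto intro: divide_nonneg_neg)
      ultimately have "\<bar>of_int n\<bar> / (- x) \<le> of_nat q - 1" "\<bar>of_int n\<bar> / (1 + x) \<le> of_nat q - 1"
        using C by linarith+
      moreover have "0 < - x" "0 < 1 + x" using 3 by simp_all
      ultimately have "\<bar>of_int n\<bar> \<le> (of_nat q - 1) * (- x)" "\<bar>of_int n\<bar> \<le> (of_nat q - 1) * (1 + x)"
        by (simp_all only: pos_divide_le_eq)
      then show "0 \<le> (1 - of_nat q) * x + of_int n \<and> (1 - of_nat q) * x + of_int n \<le> of_nat q - 1"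
        by (auto simp: algebra_simps)
    qed
  qed
qed

text \<open>As \<open>l = (1 - p ^ K) (r - v)\<close>, equality of the two fibre sums gives the
  linear relation. For the negative support only the integral entries of \<open>v\<close>, namely 0
  and -1, matter.\<close>

lemma truncation_diff_in_rel_lattice_at:
  fixes a :: "'m::finite \<Rightarrow> int ^ 'n::finite" and l :: "int ^ 'm"
  assumes "prime p"
    and v: "v \<in> R_fiber p a \<beta>" "truncation p K v V"
    and r: "r \<in> R_fiber p a \<beta>" "truncation p K r s"
    and l: "\<And>i. l $ i = int (s i) - int (V i)"
  shows "l \<in> rel_lattice_at a v"
proof -
  have p: "p \<ge> 2" using assms(1) by (rule prime_ge_2_nat)
  have vR: "v \<in> R_set p" and rR: "r \<in> R_set p" using v r by (auto simp: R_fiber_def)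
  have l': "of_int (l $ i) = (1 - of_nat p ^ K) * (r $ i - v $ i)" for i
    using v(2) r(2) l[of i] by (simp add: truncation_def right_diff_distrib)
  have "(\<Sum>i\<in>UNIV. l $ i *s a i) $ j = 0" for j
  proof -
    have fib: "(\<Sum>i\<in>UNIV. x $ i * of_int (a i $ j)) = \<beta> $ j" if "x \<in> R_fiber p a \<beta>" for x
      using that by (auto simp: R_fiber_def vec_of_int_def)
    have "of_int ((\<Sum>i\<in>UNIV. l $ i *s a i) $ j) =
        (\<Sum>i\<in>UNIV. (1 - of_nat p ^ K) * (r $ i - v $ i) * of_int (a i $ j))"
      by (simp add: l')
    also have "\<dots> = (1 - of_nat p ^ K) *
        ((\<Sum>i\<in>UNIV. r $ i * of_int (a i $ j)) - (\<Sum>i\<in>UNIV. v $ i * of_int (a i $ j)))"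
      by (simp add: sum_distrib_left sum_subtractf[symmetric] left_diff_distrib mult.assoc)
    also have "\<dots> = 0" using fib[OF v(1)] fib[OF r(1)] by simp
    finally show ?thesis by (simp only: of_int_eq_0_iff)
  qed
  then have "l \<in> rel_lattice a" by (simp add: rel_lattice_def vec_eq_iff)
  moreover have "i \<in> nsupp (v + vec_of_int l) \<longleftrightarrow> i \<in> nsupp v" for i
  proof (cases "v $ i \<in> \<int>")
    case False
    then have "v $ i + of_int (l $ i) \<notin> \<int>"
      by (metis Ints_diff Ints_of_int add_diff_cancel_right')
    then show ?thesis using False by (simp add: nsupp_def vec_of_int_def)
  next
    case True
    then obtain z where z: "v $ i = of_int z" by (rule Ints_cases)
    have "- 1 \<le> v $ i" "v $ i \<le> 0" using vR by (auto simp: R_set_def)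
    then have "of_int (- 1) \<le> v $ i" "v $ i \<le> of_int 0" by simp_all
    then have "- 1 \<le> z" "z \<le> 0" unfolding z of_int_le_iff .
    then consider "z = 0" | "z = - 1" by linarith
    then show ?thesis
    proof cases
      case 1
      \<comment> \<open>Then \<open>l $ i = s i\<close> is nonnegative, and the entry does not
        become negative.\<close>
      then have "V i = 0" using v(2) z by (simp add: truncation_def) (metis mult_zero_right of_nat_eq_0_iff)
      then show ?thesis using 1 z l[of i] by (simp add: nsupp_def vec_of_int_def)
    next
      case 2
      \<comment> \<open>An entry -1 has the largest possible truncation \<open>p ^ K - 1\<close>, so
        \<open>l $ i\<close> cannot be positive and the entry stays negative.\<close>
      have "(1 - of_nat p ^ K) * v $ i = of_nat (V i)" using v(2) by (simp add: truncation_def)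
      then have "of_nat (p ^ K) = (of_nat (V i + 1) :: rat)" using 2 z by (simp add: algebra_simps)
      then have "p ^ K = V i + 1" by (simp only: of_nat_eq_iff)
      then have "l $ i \<le> 0" using truncation_less[OF p rR r(2), of i] l[of i] by simp
      then have "(of_int (l $ i) :: rat) \<le> 0" by simp
      then show ?thesis using 2 z by (simp add: nsupp_def vec_of_int_def)
    qed
  qed
  ultimately show ?thesis by (auto simp: rel_lattice_at_def)
qed

text \<open>The condition on negative supports supplies exactly the sign conditions of
  \<open>interval_shift\<close> at entries 0 and -1; hence for large \<open>K\<close> the shifted
  vector stays in \<open>R_set p\<close>.\<close>

lemma (in padic_alg_closure) rel_lattice_at_truncation_diff:
  fixes a :: "'m::finite \<Rightarrow> int ^ 'n::finite" and l :: "int ^ 'm"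
  assumes "prime p" and v: "v \<in> R_fiber p a \<beta>" and l: "l \<in> rel_lattice_at a v"
  obtains K V r s where "truncation p K v V" and "r \<in> R_fiber p a \<beta>" and "truncation p K r s"
    and "\<And>i. l $ i = int (s i) - int (V i)"
proof -
  have p: "p \<ge> 2" using assms(1) by (rule prime_ge_2_nat)
  have vR: "v \<in> R_set p" using v by (auto simp: R_fiber_def)
  have ns: "i \<in> nsupp (v + vec_of_int l) \<longleftrightarrow> i \<in> nsupp v" for i
    using l by (auto simp: rel_lattice_at_def)
  have "\<exists>C::nat. \<forall>q\<ge>C. 0 \<le> (1 - of_nat q) * v $ i + of_int (l $ i) \<and>
           (1 - of_nat q) * v $ i + of_int (l $ i) \<le> of_nat q - 1" for i
  proof (rule interval_shift)
    show "- 1 \<le> v $ i" "v $ i \<le> 0" using vR by (auto simp: R_set_def)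
    show "0 \<le> l $ i" if "v $ i = 0" using ns[of i] that by (simp add: nsupp_def vec_of_int_def)
    show "l $ i \<le> 0" if "v $ i = - 1"
    proof -
      have "of_int (l $ i) < (of_int 1 :: rat)"
        using ns[of i] that by (simp add: nsupp_def vec_of_int_def)
      then show ?thesis unfolding of_int_less_iff by linarith
    qed
  qed
  then obtain C :: "'m \<Rightarrow> nat" where C: "\<And>i q. q \<ge> C i \<Longrightarrow>
      0 \<le> (1 - of_nat q) * v $ i + of_int (l $ i) \<and>
      (1 - of_nat q) * v $ i + of_int (l $ i) \<le> of_nat q - 1"
    by metis
  \<comment> \<open>A multiple of the period, so that \<open>V\<close> exists, and larger than every
    \<open>C i\<close>, so that \<open>p ^ K\<close> passes all thresholds.\<close>
  define K where "K = period p v * Suc (\<Sum>i\<in>UNIV. C i)"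
  have "period p v > 0" using assms(1) vR by (rule period_pos)
  then have K: "K > 0" "period p v dvd K" by (simp_all add: K_def)
  have "1 * Suc (\<Sum>i\<in>UNIV. C i) \<le> K"
    unfolding K_def using \<open>period p v > 0\<close> by (intro mult_le_mono1) simp
  then have K_ge: "Suc (\<Sum>i\<in>UNIV. C i) \<le> K" by simp
  obtain V where V: "truncation p K v V" using truncation_exists[OF assms(1) vR K] .
  have CK: "p ^ K \<ge> C i" for i
    using member_le_sum[of i UNIV C] K_ge less_prime_power[OF p, of K] by simp
  define s where "s = (\<lambda>i. nat (int (V i) + l $ i))"
  define q :: rat where "q = of_nat p ^ K"
  have q1: "q > 1" unfolding q_def using p K by (intro one_less_power) auto
  have Vq: "(1 - q) * v $ i = of_nat (V i)" for i using V by (simp add: truncation_def q_def)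
  have rng: "0 \<le> rat_of_nat (V i) + of_int (l $ i)" "rat_of_nat (V i) + of_int (l $ i) \<le> q - 1" for i
    using C[OF CK[of i]] Vq[of i] by (simp_all add: q_def)
  \<comment> \<open>Nonnegativity ensures that \<open>nat\<close> in the definition of
    \<open>s\<close> loses nothing.\<close>
  have "rat_of_int (int (V i) + l $ i) \<ge> 0" for i using rng(1)[of i] by simp
  then have s: "int (s i) = int (V i) + l $ i" for i by (simp only: s_def of_int_0_le_iff int_nat_eq if_True)
  then have s_rat: "rat_of_nat (s i) = rat_of_nat (V i) + of_int (l $ i)" for i
    by (metis of_int_add of_int_of_nat_eq)
  \<comment> \<open>Obtained by solving \<open>(1 - q) * r $ i = V i + l $ i\<close>.\<close>
  define r :: "rat ^ 'm" where "r = (\<chi> i. v $ i + of_int (l $ i) / (1 - q))"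
  have rs: "(1 - q) * r $ i = of_nat (s i)" for i
    using q1 by (simp add: r_def s_rat distrib_left Vq)
  then have r_trunc: "truncation p K r s" using K by (simp add: truncation_def q_def)
  have "0 \<le> rat_ord p (r $ i)" for i
    using rat_ord_nonneg_of_truncation[OF assms(1) K(1)] rs by (simp add: q_def)
  moreover have "r $ i = of_nat (s i) / (1 - q)" for i using rs[of i] q1 by (simp add: field_simps)
  then have "- 1 \<le> r $ i \<and> r $ i \<le> 0" for i
    using rng[of i] q1 by (simp add: s_rat neg_le_divide_eq neg_divide_le_eq)
  ultimately have "r \<in> R_set p" by (simp add: R_set_def)
  moreover have "(\<Sum>i\<in>UNIV. r $ i *s vec_of_int (a i)) = \<beta>"
  proof -
    have "(\<Sum>i\<in>UNIV. r $ i * of_int (a i $ j)) = \<beta> $ j" for j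
    proof -
      have "(\<Sum>i\<in>UNIV. l $ i * a i $ j) = 0"
        using l by (simp add: rel_lattice_at_def rel_lattice_def vec_eq_iff)
      then have l0: "(\<Sum>i\<in>UNIV. rat_of_int (l $ i) * of_int (a i $ j)) = 0"
        by (metis (mono_tags, lifting) of_int_0 of_int_mult of_int_sum sum.cong)
      have "(\<Sum>i\<in>UNIV. r $ i * of_int (a i $ j)) = (\<Sum>i\<in>UNIV. v $ i * of_int (a i $ j)) +
          (\<Sum>i\<in>UNIV. rat_of_int (l $ i) * of_int (a i $ j)) / (1 - q)"
        by (simp add: r_def distrib_right sum.distrib sum_divide_distrib)
      also have "\<dots> = \<beta> $ j" unfolding l0 using v by (auto simp: R_fiber_def vec_of_int_def)
      finally show ?thesis .
    qed
    then show ?thesis by (simp add: vec_eq_iff vec_of_int_def)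
  qed
  ultimately have "r \<in> R_fiber p a \<beta>" by (simp add: R_fiber_def)
  from that[OF V this r_trunc] s show thesis by simp
qed

section \<open>From single coefficients to the series: integrality and unboundedness\<close>

lemma Phi_eq_Phi_coeff:
  assumes "l \<in> rel_lattice_at a v"
  shows "Phi a \<pi> v (v + vec_of_int l) = Phi_coeff \<pi> v l"
proof -
  have "{l'. l' \<in> rel_lattice_at a v \<and> v + vec_of_int l' = v + vec_of_int l} = {l}"
    using assms by (auto simp: vec_of_int_def vec_eq_iff)
  then show ?thesis by (simp add: Phi_def)
qed

lemma Phi_cases:
  obtains "Phi a \<pi> v e = 0"
  | l where "l \<in> rel_lattice_at a v" and "Phi a \<pi> v e = Phi_coeff \<pi> v l"
proof (cases "\<exists>l. l \<in> rel_lattice_at a v \<and> v + vec_of_int l = e")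
  case True
  then show thesis using Phi_eq_Phi_coeff that(2) by metis
next
  case False
  then have "{l. l \<in> rel_lattice_at a v \<and> v + vec_of_int l = e} = {}" by blast
  then show thesis using that(1) unfolding Phi_def by (metis sum.empty)
qed

context padic_alg_closure
begin

lemma integral_coeffs_Phi:
  fixes a :: "'m::finite \<Rightarrow> int ^ 'n::finite"
  assumes "prime p" and "\<pi> ^ (p - 1) = - of_nat p" and v: "v \<in> R_fiber p a \<beta>"
    and min: "\<And>r. r \<in> R_fiber p a \<beta> \<Longrightarrow> weight p v \<le> weight p r"
  shows "integral_coeffs ord (Phi a \<pi> v)"
  unfolding integral_coeffs_def
proof
  fix e
  show "0 \<le> ord (Phi a \<pi> v e)"
  proof (cases rule: Phi_cases[of a \<pi> v e])
    case 1
    then show ?thesis using ord_eq_infinity_iff[of 0] by simp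
  next
    case (2 l)
    obtain K V r s where V: "truncation p K v V"
      and r: "r \<in> R_fiber p a \<beta>" "truncation p K r s"
      and l: "\<And>i. l $ i = int (s i) - int (V i)"
      using rel_lattice_at_truncation_diff[OF assms(1) v 2(1)] by metis
    have "v \<in> R_set p" "r \<in> R_set p" using v r by (auto simp: R_fiber_def)
    then have "ord (Phi_coeff \<pi> v l) = ereal (real K * (weight p r - weight p v) / real (p - 1))"
      by (intro ord_Phi_coeff[OF assms(1,2) _ V _ r(2) l])
    then show ?thesis using 2(2) min[OF r(1)] by simp
  qed
qed

lemma unbounded_coeffs_Phi:
  fixes a :: "'m::finite \<Rightarrow> int ^ 'n::finite"
  assumes "prime p" and "\<pi> ^ (p - 1) = - of_nat p"
    and v: "v \<in> R_fiber p a \<beta>" and r: "r \<in> R_fiber p a \<beta>" and less: "weight p r < weight p v"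
  shows "unbounded_coeffs ord (Phi a \<pi> v)"
  unfolding unbounded_coeffs_def
proof
  assume "\<exists>B :: real. \<forall>e. ereal B \<le> ord (Phi a \<pi> v e)"
  then obtain B :: real where B: "\<And>e. ereal B \<le> ord (Phi a \<pi> v e)" by blast
  have vR: "v \<in> R_set p" and rR: "r \<in> R_set p" using v r by (auto simp: R_fiber_def)
  define d where "d = (weight p v - weight p r) / real (p - 1)"
  have "d > 0" using less prime_gt_1_nat[OF assms(1)] by (simp add: d_def)
  then obtain n where n: "- B < real n * d" using reals_Archimedean3 by blast
  \<comment> \<open>A common multiple of both periods that is at least \<open>n\<close>: both
    truncations exist, and the order \<open>- K * d\<close> falls below \<open>B\<close>.\<close>
  define K where "K = period p v * period p r * Suc n"
  have P: "period p v > 0" "period p r > 0" using period_pos[OF assms(1)] vR rR by auto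
  then have K: "K > 0" "period p v dvd K" "period p r dvd K" by (simp_all add: K_def)
  have "1 * n \<le> period p v * period p r * Suc n" using P by (intro mult_le_mono) auto
  then have Kn: "n \<le> K" by (simp add: K_def)
  obtain V where V: "truncation p K v V" using truncation_exists[OF assms(1) vR K(1,2)] .
  obtain s where s: "truncation p K r s" using truncation_exists[OF assms(1) rR K(1,3)] .
  define l :: "int ^ 'm" where "l = (\<chi> i. int (s i) - int (V i))"
  have l: "l $ i = int (s i) - int (V i)" for i by (simp add: l_def)
  have "l \<in> rel_lattice_at a v"
    by (rule truncation_diff_in_rel_lattice_at[OF assms(1) v V r s l])
  then have "ereal B \<le> ord (Phi_coeff \<pi> v l)"
    using B[of "v + vec_of_int l"] by (simp add: Phi_eq_Phi_coeff)
  then have "B \<le> - (real K * d)"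
    using ord_Phi_coeff[OF assms(1,2) vR V rR s l]
    by (simp add: d_def minus_divide_left algebra_simps)
  moreover have "real n * d \<le> real K * d" using Kn \<open>d > 0\<close> by (intro mult_right_mono) auto
  ultimately show False using n by linarith
qed

end

theorem theorem1p5:
  fixes p :: nat
    and ord :: "'k :: {alg_closed_field, field_char_0} \<Rightarrow> ereal"
    and \<pi> :: 'k
    and a :: "'m::finite \<Rightarrow> int ^ 'n::finite"
    and \<beta> :: "rat ^ 'n"
    and v :: "rat ^ 'm"
  assumes "prime p"
    and "padic_alg_closure p ord"
    and "\<pi> ^ (p - 1) = - of_nat p"
    and "R_fiber p a \<beta> \<noteq> {}"
    and "v \<in> R_fiber p a \<beta>"
  shows "(integral_coeffs ord (Phi a \<pi> v) \<longleftrightarrow> weight p v = min_weight p a \<beta>) \<and>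
         (weight p v > min_weight p a \<beta> \<longrightarrow> unbounded_coeffs ord (Phi a \<pi> v))"
proof -
  interpret padic_alg_closure p ord by (rule assms(2))
  have "bdd_below (weight p ` R_fiber p a \<beta>)" by (auto intro!: bdd_belowI weight_nonneg)
  then have min: "min_weight p a \<beta> \<le> weight p r" if "r \<in> R_fiber p a \<beta>" for r
    unfolding min_weight_def using that by (intro cInf_lower) auto
  have unb: "unbounded_coeffs ord (Phi a \<pi> v)" if "weight p v > min_weight p a \<beta>"
  proof -
    \<comment> \<open>The infimum need not be attained here; some weight strictly below
      \<open>weight p v\<close> suffices.\<close>
    from that obtain w where "w \<in> weight p ` R_fiber p a \<beta>" "w < weight p v"
      unfolding min_weight_def using cInf_lessD assms(4) by (metis image_is_empty)
    then obtain r where "r \<in> R_fiber p a \<beta>" "weight p r < weight p v" by blast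
    then show ?thesis using assms by (intro unbounded_coeffs_Phi)
  qed
  have "integral_coeffs ord (Phi a \<pi> v)" if "weight p v = min_weight p a \<beta>"
    by (rule integral_coeffs_Phi[OF assms(1,3,5)]) (simp add: that min)
  moreover have "weight p v = min_weight p a \<beta>" if "integral_coeffs ord (Phi a \<pi> v)"
  proof (rule ccontr)
    assume "weight p v \<noteq> min_weight p a \<beta>"
    \<comment> \<open>\<open>v\<close> lies in the fibre, so a weight different from the infimum
      exceeds it; integrality would then give the lower bound 0 for all orders.\<close>
    then have "unbounded_coeffs ord (Phi a \<pi> v)" using min[OF assms(5)] by (intro unb) simp
    then show False
      using that unfolding integral_coeffs_def unbounded_coeffs_def by (metis zero_ereal_def)
  qed
  ultimately show ?thesis using unb by blast
qed

end
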